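(* Let $R$ be a ring satisfying $[x^4-x,y]=0$ for all $x,y\in R$. Then $R$ is commutative.
   Context: Rings are associative but are not assumed to have a unity. For $x,y$ in a ring, $[x,y]=xy-yx$. *)

theory Defs
  imports Main
begin

(* The class ring is that of associative rings, not assumed to have a unity;
   the power operation needs a unity, so fourth powers are written as products. *)

definition commutator :: "'a::ring \<Rightarrow> 'a \<Rightarrow> 'a" where
  "commutator x y = x * y - y * x"

end

theory Submission
  imports Defs
begin

text \<open>
  Replacing \<open>x\<close> by \<open>-x\<close> shows \<open>2[x,y] = 0\<close>. Hence the derivation \<open>\<delta> = [x,-]\<close> satisfies
  \<open>\<delta>\<^sup>2 = [x\<^sup>2,-]\<close>, and \<open>\<delta>\<^sup>4 = [x\<^sup>4,-] = \<delta>\<close>. An eigenvector \<open>[x,a] = a\<close> must vanish: \<open>[a,[a,x]] = 0\<close>,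
  so \<open>[a,x] = [a,[a,[a,[a,x]]]] = 0\<close>. For \<open>w = [x,y]\<close> the element \<open>w + \<delta> w + \<delta>\<^sup>2 w\<close> is fixed by \<open>\<delta>\<close>,
  hence zero. This says that \<open>w\<close> is fixed by \<open>[x\<^sup>2 + x,-]\<close>, so \<open>w = 0\<close>.
\<close>

lemma commutator_self: "commutator x x = 0"
  by (simp add: commutator_def)

lemma commutator_swap: "commutator y x = - commutator x y"
  by (simp add: commutator_def)

lemma commutator_zero_right: "commutator x 0 = 0"
  by (simp add: commutator_def)

lemma commutator_add_left: "commutator (x + y) z = commutator x z + commutator y z"
  by (simp add: commutator_def algebra_simps)

lemma commutator_add_right: "commutator x (y + z) = commutator x y + commutator x z"
  by (simp add: commutator_def algebra_simps)

lemma commutator_minus_right: "commutator x (- y) = - commutator x y"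
  by (simp add: commutator_def)

lemma commutator_diff_left: "commutator (x - y) z = commutator x z - commutator y z"
  by (simp add: commutator_def algebra_simps)

lemma commutator_square:
  assumes "commutator x y + commutator x y = 0"
  shows "commutator (x * x) y = commutator x (commutator x y)"
proof -
  have "commutator (x * x) y =
      commutator x (commutator x y) + (commutator x y + commutator x y) * x"
    by (simp add: commutator_def algebra_simps)
  then show ?thesis
    using assms by simp
qed

theorem theorem3p7:
  assumes "\<forall>x y :: 'a::ring. commutator (x * x * x * x - x) y = 0"
  shows "\<forall>x y :: 'a. x * y = y * x"
proof -
  have fourth: "commutator (x * x * x * x) y = commutator x y" for x y :: 'a
    using assms by (simp add: commutator_diff_left)
  have double: "commutator x y + commutator x y = 0" for x y :: 'a
  proof -
    have "commutator x y = commutator (- x) y"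
      using fourth[of x y] fourth[of "- x" y] by simp
    also have "\<dots> = - commutator x y"
      by (simp add: commutator_def)
    finally show ?thesis
      by (simp add: eq_neg_iff_add_eq_0)
  qed
  have square: "commutator (x * x) y = commutator x (commutator x y)" for x y :: 'a
    by (rule commutator_square[OF double])
  have ad4: "commutator x (commutator x (commutator x (commutator x y))) = commutator x y"
    for x y :: 'a
    \<comment> \<open>The fourth power is the square of \<open>x * x\<close>: apply
      \<open>square\<close> at \<open>x * x\<close>, then twice at \<open>x\<close>.\<close>
    using fourth[of x y] square[of "x * x" y] by (simp add: square mult.assoc)
  have fixed_zero: "a = 0" if a: "commutator x a = a" for x a :: 'a
  proof -
    \<comment> \<open>The inner commutator is \<open>- a\<close>, which commutes with
      \<open>a\<close>.\<close>
    have "commutator a (commutator a x) = 0"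
      by (simp add: commutator_swap[of a x] a commutator_minus_right commutator_self)
    then have "commutator a x = 0"
      using ad4[of a x] by (simp add: commutator_zero_right)
    then show ?thesis
      using a by (simp add: commutator_swap[of x a])
  qed
  have "commutator x y = 0" for x y :: 'a
  proof -
    define w where "w = commutator x y"
    \<comment> \<open>Bracketing with \<open>x\<close> permutes the three summands cyclically: by
      \<open>ad4\<close> the last one returns to \<open>w\<close>.\<close>
    have "w + commutator x w + commutator x (commutator x w) = 0"
      by (rule fixed_zero[of x]) (simp add: commutator_add_right w_def ad4 add_ac)
    \<comment> \<open>By \<open>square\<close>, the left side is the sum of the last two summands
      above.\<close>
    then have "commutator (x * x + x) w = - w"
      by (simp add: commutator_add_left square eq_neg_iff_add_eq_0 add_ac)
    moreover have "- w = w"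
      using double[of x y] by (simp add: w_def neg_eq_iff_add_eq_0)
    ultimately show ?thesis
      using fixed_zero[of "x * x + x" w] by (simp add: w_def)
  qed
  then show ?thesis
    by (simp add: commutator_def)
qed

end
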